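(* Let $x\in\overline{\mathbb K}_f$. (i) $x$ is a unit of $\overline{\mathbb K}_f$ if and only if $Z(\hat x)\notin\mathcal S_f$ for every representative $\hat x$ of $x$. (ii) $x$ is not a unit of $\overline{\mathbb K}_f$ if and only if there exists $e\in\overline{\mathbb K}_f$ with $e\ne0$, $e^2=e$ and $x\cdot e=0$. In particular, if $x\neq0$ is not a unit, then $x$ is a zero divisor.
   Context: $\mathbb K$ is $\mathbb R$ or $\mathbb C$, $I=]0,1]$, $\mathbb N=\{0,1,2,\dots\}$. $\mathcal A_0$ is the set of real-valued $\varphi\in C_c^\infty(\mathbb R)$ that are even, constant in a neighbourhood of $0$, and satisfy $\int_0^\infty\varphi(x)\,dx=\tfrac12$. For $q\in\mathbb N$, $\mathcal A_q=\{\varphi\in\mathcal A_0:\int_0^\infty x^{j/m}\varphi(x)\,dx=0\text{ for all integers }1\le j,m\le q\}$. For $\varepsilon\in I$, $\varphi_\varepsilon(x)=\varepsilon^{-1}\varphi(x/\varepsilon)$. $\Gamma$ is the set of strictly increasing $\gamma:\mathbb N\to[0,\infty)$ with $\gamma(n)\to\infty$. $\mathcal E_f^M(\mathbb K)$ is the ring (pointwise operations) of functions $v:\mathcal A_0\to\mathbb K$ such that there is $p\in\mathbb N$ such that for all $\varphi\in\mathcal A_p$ there are $C,\eta>0$ with $|v(\varphi_\varepsilon)|\le C\varepsilon^{-p}$ for all $\varepsilon\in I$, $\varepsilon<\eta$. $\mathcal N_f(\mathbb K)$ is the ideal of those $v\in\mathcal E_f^M(\mathbb K)$ for which there are $p\in\mathbb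 N$, $\gamma\in\Gamma$ such that for all $q\ge p$ and $\varphi\in\mathcal A_q$ there are $C,\eta>0$ with $|v(\varphi_\varepsilon)|\le C\varepsilon^{\gamma(q)-p}$ for all $\varepsilon\in I$, $\varepsilon<\eta$. $\overline{\mathbb K}_f=\mathcal E_f^M(\mathbb K)/\mathcal N_f(\mathbb K)$; a representative of $x\in\overline{\mathbb K}_f$ is any $\hat x\in\mathcal E_f^M(\mathbb K)$ in the class $x$. $Z(\hat x)=\{\varphi\in\mathcal A_0:\hat x(\varphi)=0\}$. $\mathcal S=\{S\subset I:0\in\overline S\cap\overline{I\setminus S}\}$ and $\mathcal S_f=\{A\subset\mathcal A_0:\forall p\in\mathbb N\ \exists\varphi\in\mathcal A_p\text{ with }\{\varepsilon\in I:\varphi_\varepsilon\in A\}\in\mathcal S\}$. *)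

theory Defs
  imports "HOL-Analysis.Analysis" "HOL-Algebra.QuotRing"
begin

section \<open>Test functions\<close>

definition unit_interval :: "real set" where
  "unit_interval = {0<..1}"

definition smooth :: "(real \<Rightarrow> real) \<Rightarrow> bool" where
  "smooth \<phi> \<longleftrightarrow> (\<forall>n. (deriv ^^ n) \<phi> differentiable_on UNIV)"

definition test_functions :: "(real \<Rightarrow> real) set" where
  "test_functions =
     {\<phi>. smooth \<phi> \<and> compact (closure {x. \<phi> x \<noteq> 0}) \<and>
         (\<forall>x. \<phi> (- x) = \<phi> x) \<and>
         (\<exists>c. \<forall>\<^sub>F x in nhds 0. \<phi> x = c) \<and>
         integral {0..} \<phi> = 1 / 2}"

definition mollifiers :: "nat \<Rightarrow> (real \<Rightarrow> real) set" where
  "mollifiers q =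
     {\<phi> \<in> test_functions.
        \<forall>j m. 1 \<le> j \<and> j \<le> q \<and> 1 \<le> m \<and> m \<le> q \<longrightarrow>
          integral {0..} (\<lambda>x. x powr (real j / real m) * \<phi> x) = 0}"

definition rescale :: "real \<Rightarrow> (real \<Rightarrow> real) \<Rightarrow> (real \<Rightarrow> real)" where
  "rescale \<epsilon> \<phi> = (\<lambda>x. \<phi> (x / \<epsilon>) / \<epsilon>)"

section \<open>Full Colombeau generalized numbers\<close>

text \<open>
  The scalars are an arbitrary type of class \<^class>\<open>real_normed_field\<close>. Its norm is multiplicative,
  so by the Gelfand-Mazur theorem such a type is isometrically isomorphic to the reals or to the
  complex numbers, and both are instances.

  A function on \<^term>\<open>test_functions\<close> is encoded as a HOL function that is
  \<^const>\<open>undefined\<close> outside \<^term>\<open>test_functions\<close>.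
\<close>

definition moderate :: "((real \<Rightarrow> real) \<Rightarrow> 'a::real_normed_field) \<Rightarrow> bool" where
  "moderate v \<longleftrightarrow>
     (\<exists>p::nat. \<forall>\<phi>\<in>mollifiers p. \<exists>C>0. \<exists>\<eta>>0.
        \<forall>\<epsilon>\<in>unit_interval. \<epsilon> < \<eta> \<longrightarrow> norm (v (rescale \<epsilon> \<phi>)) \<le> C * \<epsilon> powr (- real p))"

definition moderate_ring :: "((real \<Rightarrow> real) \<Rightarrow> 'a::real_normed_field) ring" where
  "moderate_ring =
     \<lparr>carrier = {v \<in> extensional test_functions. moderate v},
      mult = (\<lambda>v w. \<lambda>\<phi>\<in>test_functions. v \<phi> * w \<phi>),
      one = (\<lambda>\<phi>\<in>test_functions. 1),
      zero = (\<lambda>\<phi>\<in>test_functions. 0),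
      add = (\<lambda>v w. \<lambda>\<phi>\<in>test_functions. v \<phi> + w \<phi>)\<rparr>"

definition growth_sequences :: "(nat \<Rightarrow> real) set" where
  "growth_sequences =
     {\<gamma>. strict_mono \<gamma> \<and> (\<forall>n. 0 \<le> \<gamma> n) \<and> filterlim \<gamma> at_top sequentially}"

definition negligible_ideal :: "((real \<Rightarrow> real) \<Rightarrow> 'a::real_normed_field) set" where
  "negligible_ideal =
     {v \<in> carrier moderate_ring.
        \<exists>p::nat. \<exists>\<gamma>\<in>growth_sequences. \<forall>q\<ge>p. \<forall>\<phi>\<in>mollifiers q. \<exists>C>0. \<exists>\<eta>>0.
          \<forall>\<epsilon>\<in>unit_interval. \<epsilon> < \<eta> \<longrightarrow>
            norm (v (rescale \<epsilon> \<phi>)) \<le> C * \<epsilon> powr (\<gamma> q - real p)}"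

definition generalized_numbers :: "((real \<Rightarrow> real) \<Rightarrow> 'a::real_normed_field) set ring" where
  "generalized_numbers = moderate_ring Quot negligible_ideal"

definition representative ::
    "((real \<Rightarrow> real) \<Rightarrow> 'a::real_normed_field) \<Rightarrow> ((real \<Rightarrow> real) \<Rightarrow> 'a) set \<Rightarrow> bool" where
  "representative v x \<longleftrightarrow> v \<in> carrier moderate_ring \<and> v \<in> x"

definition zero_set :: "((real \<Rightarrow> real) \<Rightarrow> 'a::real_normed_field) \<Rightarrow> (real \<Rightarrow> real) set" where
  "zero_set v = {\<phi> \<in> test_functions. v \<phi> = 0}"

definition oscillating_sets :: "real set set" where
  "oscillating_sets = {S. S \<subseteq> unit_interval \<and> 0 \<in> closure S \<inter> closure (unit_interval - S)}"

definition full_oscillating_sets :: "(real \<Rightarrow> real) set set" where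
  "full_oscillating_sets =
     {A. A \<subseteq> test_functions \<and>
         (\<forall>p. \<exists>\<phi>\<in>mollifiers p. {\<epsilon> \<in> unit_interval. rescale \<epsilon> \<phi> \<in> A} \<in> oscillating_sets)}"

definition zero_divisor :: "('b, 'm) ring_scheme \<Rightarrow> 'b \<Rightarrow> bool" where
  "zero_divisor R a \<longleftrightarrow>
     a \<in> carrier R \<and> a \<noteq> \<zero>\<^bsub>R\<^esub> \<and>
     (\<exists>b\<in>carrier R. b \<noteq> \<zero>\<^bsub>R\<^esub> \<and> a \<otimes>\<^bsub>R\<^esub> b = \<zero>\<^bsub>R\<^esub>)"

section \<open>Well-definedness of the quotient\<close>

lemma higher_deriv_rescale:
  assumes "smooth \<phi>" "\<epsilon> > 0"
  shows "(deriv ^^ n) (rescale \<epsilon> \<phi>) = (\<lambda>x. (deriv ^^ n) \<phi> (x / \<epsilon>) / \<epsilon> ^ Suc n)"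
proof (induction n)
  case 0
  then show ?case by (simp add: rescale_def)
next
  case (Suc n)
  have "((\<lambda>x. (deriv ^^ n) \<phi> (x / \<epsilon>) / \<epsilon> ^ Suc n) has_field_derivative
         deriv ((deriv ^^ n) \<phi>) (x / \<epsilon>) / \<epsilon> ^ Suc (Suc n)) (at x)" for x
  proof -
    have "(deriv ^^ n) \<phi> differentiable at (x / \<epsilon>)"
      using assms(1) by (auto simp: smooth_def differentiable_on_def)
    then have "((deriv ^^ n) \<phi> has_field_derivative deriv ((deriv ^^ n) \<phi>) (x / \<epsilon>)) (at (x / \<epsilon>))"
      by (simp add: DERIV_deriv_iff_real_differentiable)
    moreover have "((\<lambda>x. x / \<epsilon>) has_field_derivative 1 / \<epsilon>) (at x)"
      using assms(2) by (auto intro!: derivative_eq_intros)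
    ultimately have "((\<lambda>x. (deriv ^^ n) \<phi> (x / \<epsilon>)) has_field_derivative
        deriv ((deriv ^^ n) \<phi>) (x / \<epsilon>) * (1 / \<epsilon>)) (at x)"
      by (rule DERIV_chain2)
    then show ?thesis
      using assms(2) by (auto dest: DERIV_cdivide[where c = "\<epsilon> ^ Suc n"] simp: field_simps)
  qed
  then show ?case
    using Suc by (auto intro!: DERIV_imp_deriv)
qed

lemma smooth_rescale:
  assumes "smooth \<phi>" "\<epsilon> > 0"
  shows "smooth (rescale \<epsilon> \<phi>)"
  unfolding smooth_def higher_deriv_rescale[OF assms]
proof (intro allI)
  fix n
  have "(deriv ^^ n) \<phi> differentiable at (x / \<epsilon>)" for x
    using assms(1) by (auto simp: smooth_def differentiable_on_def)
  moreover have "(\<lambda>x. x / \<epsilon>) differentiable at x" for x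
    using assms(2) by (auto intro!: derivative_intros)
  ultimately have "(\<lambda>x. (deriv ^^ n) \<phi> (x / \<epsilon>)) differentiable at x" for x
    using differentiable_chain_at[of "\<lambda>x. x / \<epsilon>" x "(deriv ^^ n) \<phi>"] by (simp add: o_def)
  then show "(\<lambda>x. (deriv ^^ n) \<phi> (x / \<epsilon>) / \<epsilon> ^ Suc n) differentiable_on UNIV"
    using assms(2) by (auto simp: differentiable_on_def intro!: derivative_intros)
qed

lemma has_integral_rescale_half_line:
  fixes f :: "real \<Rightarrow> real"
  assumes "\<epsilon> > 0" "\<And>x. x > b \<Longrightarrow> f x = 0" "(f has_integral i) {0..}"
  shows "((\<lambda>x. f (x / \<epsilon>)) has_integral \<epsilon> * i) {0..}"
proof -
  have "(f has_integral i) (cbox 0 b)"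
  proof -
    have "(f has_integral i) {0..b} \<longleftrightarrow> (f has_integral i) {0..}"
      by (rule has_integral_spike_set_eq) (auto intro!: negligible_subset[of "{}"] simp: assms(2))
    then show ?thesis using assms(3) by simp
  qed
  then have "((\<lambda>x. f (x / \<epsilon>)) has_integral \<epsilon> * i) {0..b * \<epsilon>}"
    using has_integral_affinity_iff[of "1 / \<epsilon>" f 0 i 0 b] assms(1)
    by (simp add: field_simps)
  moreover have "((\<lambda>x. f (x / \<epsilon>)) has_integral \<epsilon> * i) {0..b * \<epsilon>} \<longleftrightarrow>
      ((\<lambda>x. f (x / \<epsilon>)) has_integral \<epsilon> * i) {0..}"
    using assms(1)
    by (intro has_integral_spike_set_eq)
       (auto intro!: negligible_subset[of "{}"] assms(2) simp: field_simps)
  ultimately show ?thesis by simp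
qed

lemma integral_rescale_half_line:
  fixes f :: "real \<Rightarrow> real"
  assumes "\<epsilon> > 0" "\<And>x. x > b \<Longrightarrow> f x = 0"
  shows "integral {0..} (\<lambda>x. f (x / \<epsilon>)) = \<epsilon> * integral {0..} f"
proof (cases "f integrable_on {0..}")
  case True
  then have "(f has_integral integral {0..} f) {0..}"
    by (rule integrable_integral)
  then show ?thesis
    by (intro integral_unique has_integral_rescale_half_line[of \<epsilon> b f] assms)
next
  case False
  have "\<not> (\<lambda>x. f (x / \<epsilon>)) integrable_on {0..}"
  proof
    assume "(\<lambda>x. f (x / \<epsilon>)) integrable_on {0..}"
    then obtain i where i: "((\<lambda>x. f (x / \<epsilon>)) has_integral i) {0..}"
      unfolding integrable_on_def by (rule exE)
    have "f (x / \<epsilon>) = 0" if "x > b * \<epsilon>" for x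
      using that assms by (simp add: field_simps)
    then have "((\<lambda>x. f (x / (1 / \<epsilon>) / \<epsilon>)) has_integral (1 / \<epsilon>) * i) {0..}"
      using has_integral_rescale_half_line[of "1 / \<epsilon>" "b * \<epsilon>" "\<lambda>x. f (x / \<epsilon>)" i] assms(1) i by simp
    then show False
      using False assms(1) by (simp add: has_integral_integrable_integral)
  qed
  then show ?thesis
    using False by (simp add: not_integrable_integral)
qed

lemma test_functions_vanish:
  assumes "\<phi> \<in> test_functions"
  obtains b where "\<And>x. x > b \<Longrightarrow> \<phi> x = 0"
proof -
  have "bounded {x. \<phi> x \<noteq> 0}"
    using assms bounded_subset[OF _ closure_subset]
    by (auto simp: test_functions_def compact_eq_bounded_closed)
  then obtain b where "\<forall>x\<in>{x. \<phi> x \<noteq> 0}. norm x \<le> b"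
    using bounded_iff by blast
  then show ?thesis
    using that[of b] by fastforce
qed

lemma rescale_test_functions:
  assumes "\<phi> \<in> test_functions" "\<epsilon> > 0"
  shows "rescale \<epsilon> \<phi> \<in> test_functions"
proof -
  obtain b where b: "\<And>x. x > b \<Longrightarrow> \<phi> x = 0"
    using test_functions_vanish[OF assms(1)] by blast
  have "compact (closure {x. rescale \<epsilon> \<phi> x \<noteq> 0})"
  proof -
    have "{x. rescale \<epsilon> \<phi> x \<noteq> 0} = (\<lambda>x. \<epsilon> *\<^sub>R x) ` {x. \<phi> x \<noteq> 0}"
      using assms(2) by (auto simp: rescale_def image_iff intro!: exI[of _ "_ / \<epsilon>"])
    moreover have "bounded {x. \<phi> x \<noteq> 0}"
      using assms(1) bounded_subset[OF _ closure_subset]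
      by (auto simp: test_functions_def compact_eq_bounded_closed)
    ultimately show ?thesis
      by (metis bounded_scaling bounded_closure closed_closure compact_eq_bounded_closed)
  qed
  moreover have "\<exists>c. \<forall>\<^sub>F x in nhds 0. rescale \<epsilon> \<phi> x = c"
  proof -
    obtain c where c: "\<forall>\<^sub>F x in nhds 0. \<phi> x = c"
      using assms(1) by (auto simp: test_functions_def)
    have "((\<lambda>x. x / \<epsilon>) \<longlongrightarrow> 0 / \<epsilon>) (nhds 0)"
      using assms(2) by (intro tendsto_intros filterlim_ident) auto
    then have "filterlim (\<lambda>x. x / \<epsilon>) (nhds 0) (nhds 0)"
      by simp
    with c have "\<forall>\<^sub>F x in nhds 0. \<phi> (x / \<epsilon>) = c"
      by (auto simp: filterlim_iff)
    then have "\<forall>\<^sub>F x in nhds 0. rescale \<epsilon> \<phi> x = c / \<epsilon>"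
      by eventually_elim (simp add: rescale_def)
    then show ?thesis by blast
  qed
  moreover have "integral {0..} (rescale \<epsilon> \<phi>) = 1 / 2"
    using integral_rescale_half_line[of \<epsilon> b \<phi>] b assms by (simp add: rescale_def test_functions_def)
  ultimately show ?thesis
    using assms smooth_rescale[of \<phi> \<epsilon>] by (simp add: test_functions_def) (simp add: rescale_def)
qed

lemma rescale_mollifiers:
  assumes "\<phi> \<in> mollifiers q" "\<epsilon> > 0"
  shows "rescale \<epsilon> \<phi> \<in> mollifiers q"
proof -
  have \<phi>: "\<phi> \<in> test_functions"
    using assms(1) by (simp add: mollifiers_def)
  obtain b where b: "\<And>x. x > b \<Longrightarrow> \<phi> x = 0"
    using test_functions_vanish[OF \<phi>] by blast
  have "integral {0..} (\<lambda>x. x powr a * rescale \<epsilon> \<phi> x) = 0"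
    if "integral {0..} (\<lambda>x. x powr a * \<phi> x) = 0" for a
  proof -
    have "integral {0..} (\<lambda>x. x powr a * rescale \<epsilon> \<phi> x) =
        integral {0..} (\<lambda>x. \<epsilon> powr a / \<epsilon> * ((x / \<epsilon>) powr a * \<phi> (x / \<epsilon>)))"
      using assms(2) by (intro integral_cong) (auto simp: rescale_def powr_divide)
    also have "\<dots> = \<epsilon> powr a / \<epsilon> * integral {0..} (\<lambda>x. (x / \<epsilon>) powr a * \<phi> (x / \<epsilon>))"
      by (rule integral_mult_right)
    also have "integral {0..} (\<lambda>x. (x / \<epsilon>) powr a * \<phi> (x / \<epsilon>)) =
        \<epsilon> * integral {0..} (\<lambda>x. x powr a * \<phi> x)"
      using integral_rescale_half_line[OF assms(2), of b "\<lambda>x. x powr a * \<phi> x"] b by simp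
    finally show ?thesis using that by simp
  qed
  then show ?thesis
    using assms \<phi> by (auto simp: mollifiers_def rescale_test_functions)
qed

lemma mollifiers_mono:
  assumes "p \<le> q"
  shows "mollifiers q \<subseteq> mollifiers p"
proof
  fix \<phi> assume \<phi>: "\<phi> \<in> mollifiers q"
  have "integral {0..} (\<lambda>x. x powr (real j / real m) * \<phi> x) = 0"
    if "1 \<le> j \<and> j \<le> p \<and> 1 \<le> m \<and> m \<le> p" for j m
  proof -
    have "1 \<le> j \<and> j \<le> q \<and> 1 \<le> m \<and> m \<le> q"
      using that assms by linarith
    then show ?thesis
      using \<phi> unfolding mollifiers_def by blast
  qed
  then show "\<phi> \<in> mollifiers p"
    using \<phi> unfolding mollifiers_def by blast
qed

lemma rescale_mollifiers_test [simp]: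
  assumes "\<phi> \<in> mollifiers q" "\<epsilon> \<in> unit_interval"
  shows "rescale \<epsilon> \<phi> \<in> test_functions"
  using assms by (intro rescale_test_functions) (simp_all add: unit_interval_def mollifiers_def)

lemma moderate_add:
  assumes "moderate v" "moderate w"
  shows "moderate (\<lambda>\<phi>\<in>test_functions. v \<phi> + w \<phi>)"
proof -
  obtain p where p: "\<And>\<phi>. \<phi> \<in> mollifiers p \<Longrightarrow> \<exists>C>0. \<exists>\<eta>>0. \<forall>\<epsilon>\<in>unit_interval. \<epsilon> < \<eta> \<longrightarrow>
      norm (v (rescale \<epsilon> \<phi>)) \<le> C * \<epsilon> powr (- real p)"
    using assms(1) unfolding moderate_def by blast
  obtain q where q: "\<And>\<phi>. \<phi> \<in> mollifiers q \<Longrightarrow> \<exists>C>0. \<exists>\<eta>>0. \<forall>\<epsilon>\<in>unit_interval. \<epsilon> < \<eta> \<longrightarrow>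
      norm (w (rescale \<epsilon> \<phi>)) \<le> C * \<epsilon> powr (- real q)"
    using assms(2) unfolding moderate_def by blast
  show ?thesis
    unfolding moderate_def
  proof (intro exI[of _ "p + q"] ballI)
    fix \<phi> assume \<phi>: "\<phi> \<in> mollifiers (p + q)"
    then have "\<phi> \<in> mollifiers p" "\<phi> \<in> mollifiers q"
      using mollifiers_mono[of p "p + q"] mollifiers_mono[of q "p + q"] by auto
    then obtain C \<eta> D \<delta> where *: "C > 0" "\<eta> > 0" "D > 0" "\<delta> > 0"
      "\<And>\<epsilon>. \<epsilon> \<in> unit_interval \<Longrightarrow> \<epsilon> < \<eta> \<Longrightarrow> norm (v (rescale \<epsilon> \<phi>)) \<le> C * \<epsilon> powr (- real p)"
      "\<And>\<epsilon>. \<epsilon> \<in> unit_interval \<Longrightarrow> \<epsilon> < \<delta> \<Longrightarrow> norm (w (rescale \<epsilon> \<phi>)) \<le> D * \<epsilon> powr (- real q)"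
      using p q by metis
    have "norm ((\<lambda>\<phi>\<in>test_functions. v \<phi> + w \<phi>) (rescale \<epsilon> \<phi>)) \<le> (C + D) * \<epsilon> powr (- real (p + q))"
      if \<epsilon>: "\<epsilon> \<in> unit_interval" "\<epsilon> < min \<eta> \<delta>" for \<epsilon>
    proof -
      have "norm (v (rescale \<epsilon> \<phi>) + w (rescale \<epsilon> \<phi>)) \<le> C * \<epsilon> powr (- real p) + D * \<epsilon> powr (- real q)"
        using *(5,6)[of \<epsilon>] \<epsilon> by (intro norm_triangle_le add_mono) auto
      also have "\<dots> \<le> C * \<epsilon> powr (- real (p + q)) + D * \<epsilon> powr (- real (p + q))"
        using * \<epsilon> by (intro add_mono mult_left_mono powr_mono') (auto simp: unit_interval_def)
      finally show ?thesis
        using \<phi> \<epsilon> by (simp add: algebra_simps)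
    qed
    then show "\<exists>C>0. \<exists>\<eta>>0. \<forall>\<epsilon>\<in>unit_interval. \<epsilon> < \<eta> \<longrightarrow>
        norm ((\<lambda>\<phi>\<in>test_functions. v \<phi> + w \<phi>) (rescale \<epsilon> \<phi>)) \<le> C * \<epsilon> powr (- real (p + q))"
      using * by (intro exI[of _ "C + D"] conjI exI[of _ "min \<eta> \<delta>"]) auto
  qed
qed

lemma moderate_mult:
  assumes "moderate v" "moderate w"
  shows "moderate (\<lambda>\<phi>\<in>test_functions. v \<phi> * w \<phi>)"
proof -
  obtain p where p: "\<And>\<phi>. \<phi> \<in> mollifiers p \<Longrightarrow> \<exists>C>0. \<exists>\<eta>>0. \<forall>\<epsilon>\<in>unit_interval. \<epsilon> < \<eta> \<longrightarrow>
      norm (v (rescale \<epsilon> \<phi>)) \<le> C * \<epsilon> powr (- real p)"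
    using assms(1) unfolding moderate_def by blast
  obtain q where q: "\<And>\<phi>. \<phi> \<in> mollifiers q \<Longrightarrow> \<exists>C>0. \<exists>\<eta>>0. \<forall>\<epsilon>\<in>unit_interval. \<epsilon> < \<eta> \<longrightarrow>
      norm (w (rescale \<epsilon> \<phi>)) \<le> C * \<epsilon> powr (- real q)"
    using assms(2) unfolding moderate_def by blast
  show ?thesis
    unfolding moderate_def
  proof (intro exI[of _ "p + q"] ballI)
    fix \<phi> assume \<phi>: "\<phi> \<in> mollifiers (p + q)"
    then have "\<phi> \<in> mollifiers p" "\<phi> \<in> mollifiers q"
      using mollifiers_mono[of p "p + q"] mollifiers_mono[of q "p + q"] by auto
    then obtain C \<eta> D \<delta> where *: "C > 0" "\<eta> > 0" "D > 0" "\<delta> > 0"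
      "\<And>\<epsilon>. \<epsilon> \<in> unit_interval \<Longrightarrow> \<epsilon> < \<eta> \<Longrightarrow> norm (v (rescale \<epsilon> \<phi>)) \<le> C * \<epsilon> powr (- real p)"
      "\<And>\<epsilon>. \<epsilon> \<in> unit_interval \<Longrightarrow> \<epsilon> < \<delta> \<Longrightarrow> norm (w (rescale \<epsilon> \<phi>)) \<le> D * \<epsilon> powr (- real q)"
      using p q by metis
    have "norm ((\<lambda>\<phi>\<in>test_functions. v \<phi> * w \<phi>) (rescale \<epsilon> \<phi>)) \<le> (C * D) * \<epsilon> powr (- real (p + q))"
      if \<epsilon>: "\<epsilon> \<in> unit_interval" "\<epsilon> < min \<eta> \<delta>" for \<epsilon>
    proof -
      have "norm (v (rescale \<epsilon> \<phi>) * w (rescale \<epsilon> \<phi>)) \<le>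
          (C * \<epsilon> powr (- real p)) * (D * \<epsilon> powr (- real q))"
        unfolding norm_mult using *(5,6)[of \<epsilon>] * \<epsilon> by (intro mult_mono) auto
      also have "\<dots> = (C * D) * \<epsilon> powr (- real p + - real q)"
        by (simp only: powr_add mult_ac)
      finally show ?thesis
        using \<phi> \<epsilon> by simp
    qed
    then show "\<exists>C>0. \<exists>\<eta>>0. \<forall>\<epsilon>\<in>unit_interval. \<epsilon> < \<eta> \<longrightarrow>
        norm ((\<lambda>\<phi>\<in>test_functions. v \<phi> * w \<phi>) (rescale \<epsilon> \<phi>)) \<le> C * \<epsilon> powr (- real (p + q))"
      using * by (intro exI[of _ "C * D"] conjI exI[of _ "min \<eta> \<delta>"]) auto
  qed
qed

lemma moderate_const: "moderate (\<lambda>\<phi>\<in>test_functions. c)"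
  unfolding moderate_def
  by (intro exI[of _ 0] ballI exI[of _ "norm c + 1"] conjI exI[of _ 1])
     (auto simp: unit_interval_def mollifiers_def rescale_test_functions intro: add_nonneg_pos)

theorem cring_moderate_ring: "cring (moderate_ring :: ((real \<Rightarrow> real) \<Rightarrow> 'a::real_normed_field) ring)"
proof (rule cringI)
  show "abelian_group (moderate_ring :: ((real \<Rightarrow> real) \<Rightarrow> 'a) ring)"
  proof (rule abelian_groupI)
    fix v :: "(real \<Rightarrow> real) \<Rightarrow> 'a"
    assume v: "v \<in> carrier moderate_ring"
    have "moderate (\<lambda>\<phi>\<in>test_functions. (\<lambda>\<phi>\<in>test_functions. - 1) \<phi> * v \<phi>)"
      using v by (intro moderate_mult moderate_const) (simp add: moderate_ring_def)
    also have "(\<lambda>\<phi>\<in>test_functions. (\<lambda>\<phi>\<in>test_functions. - 1) \<phi> * v \<phi>) = (\<lambda>\<phi>\<in>test_functions. - v \<phi>)"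
      by (rule restrict_ext) simp
    finally have "(\<lambda>\<phi>\<in>test_functions. - v \<phi>) \<in> carrier moderate_ring"
      by (simp only: moderate_ring_def partial_object.simps mem_Collect_eq restrict_extensional simp_thms)
    moreover have "(\<lambda>\<phi>\<in>test_functions. - v \<phi>) \<oplus>\<^bsub>moderate_ring\<^esub> v = \<zero>\<^bsub>moderate_ring\<^esub>"
      by (auto simp: moderate_ring_def fun_eq_iff)
    ultimately show "\<exists>w\<in>carrier moderate_ring. w \<oplus>\<^bsub>moderate_ring\<^esub> v = \<zero>\<^bsub>moderate_ring\<^esub>"
      by blast
  qed (auto simp: moderate_ring_def moderate_add moderate_const fun_eq_iff extensional_def)
  show "comm_monoid (moderate_ring :: ((real \<Rightarrow> real) \<Rightarrow> 'a) ring)"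
    by (rule comm_monoidI)
       (auto simp: moderate_ring_def moderate_mult moderate_const fun_eq_iff extensional_def)
qed (auto simp: moderate_ring_def fun_eq_iff algebra_simps)

lemma negligible_zero: "\<zero>\<^bsub>moderate_ring\<^esub> \<in> negligible_ideal"
proof -
  have "real \<in> growth_sequences"
    by (simp add: growth_sequences_def strict_mono_def filterlim_real_sequentially)
  then show ?thesis
    unfolding negligible_ideal_def
    by (auto intro!: exI[of _ 0] bexI[of _ real] exI[of _ 1]
        simp: moderate_ring_def moderate_const)
qed

lemma growth_sequences_min:
  assumes "\<gamma> \<in> growth_sequences" "\<delta> \<in> growth_sequences"
  shows "(\<lambda>n. min (\<gamma> n) (\<delta> n)) \<in> growth_sequences"
proof -
  have "strict_mono (\<lambda>n. min (\<gamma> n) (\<delta> n))"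
    using assms by (fastforce simp: growth_sequences_def strict_mono_def min_def)
  moreover have "filterlim (\<lambda>n. min (\<gamma> n) (\<delta> n)) at_top sequentially"
    using assms by (auto simp: growth_sequences_def filterlim_at_top intro: eventually_elim2)
  ultimately show ?thesis
    using assms by (auto simp: growth_sequences_def)
qed

lemma negligible_add:
  assumes "v \<in> negligible_ideal" "w \<in> negligible_ideal"
  shows "v \<oplus>\<^bsub>moderate_ring\<^esub> w \<in> negligible_ideal"
proof -
  obtain p \<gamma> where p: "\<gamma> \<in> growth_sequences" "\<And>q \<phi>. q \<ge> p \<Longrightarrow> \<phi> \<in> mollifiers q \<Longrightarrow>
      \<exists>C>0. \<exists>\<eta>>0. \<forall>\<epsilon>\<in>unit_interval. \<epsilon> < \<eta> \<longrightarrow> norm (v (rescale \<epsilon> \<phi>)) \<le> C * \<epsilon> powr (\<gamma> q - real p)"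
    using assms(1) unfolding negligible_ideal_def by blast
  obtain r \<delta> where r: "\<delta> \<in> growth_sequences" "\<And>q \<phi>. q \<ge> r \<Longrightarrow> \<phi> \<in> mollifiers q \<Longrightarrow>
      \<exists>C>0. \<exists>\<eta>>0. \<forall>\<epsilon>\<in>unit_interval. \<epsilon> < \<eta> \<longrightarrow> norm (w (rescale \<epsilon> \<phi>)) \<le> C * \<epsilon> powr (\<delta> q - real r)"
    using assms(2) unfolding negligible_ideal_def by blast
  define \<kappa> where "\<kappa> = (\<lambda>n. min (\<gamma> n) (\<delta> n))"
  have "\<exists>C>0. \<exists>\<eta>>0. \<forall>\<epsilon>\<in>unit_interval. \<epsilon> < \<eta> \<longrightarrow>
      norm ((v \<oplus>\<^bsub>moderate_ring\<^esub> w) (rescale \<epsilon> \<phi>)) \<le> C * \<epsilon> powr (\<kappa> q - real (p + r))"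
    if q: "q \<ge> p + r" and \<phi>: "\<phi> \<in> mollifiers q" for q \<phi>
  proof -
    obtain C \<eta> D \<theta> where *: "C > 0" "\<eta> > 0" "D > 0" "\<theta> > 0"
      "\<And>\<epsilon>. \<epsilon> \<in> unit_interval \<Longrightarrow> \<epsilon> < \<eta> \<Longrightarrow> norm (v (rescale \<epsilon> \<phi>)) \<le> C * \<epsilon> powr (\<gamma> q - real p)"
      "\<And>\<epsilon>. \<epsilon> \<in> unit_interval \<Longrightarrow> \<epsilon> < \<theta> \<Longrightarrow> norm (w (rescale \<epsilon> \<phi>)) \<le> D * \<epsilon> powr (\<delta> q - real r)"
      using p(2)[OF _ \<phi>] r(2)[OF _ \<phi>] q by (metis add_leE)
    have "norm ((v \<oplus>\<^bsub>moderate_ring\<^esub> w) (rescale \<epsilon> \<phi>)) \<le> (C + D) * \<epsilon> powr (\<kappa> q - real (p + r))"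
      if \<epsilon>: "\<epsilon> \<in> unit_interval" "\<epsilon> < min \<eta> \<theta>" for \<epsilon>
    proof -
      have "norm (v (rescale \<epsilon> \<phi>) + w (rescale \<epsilon> \<phi>)) \<le>
          C * \<epsilon> powr (\<gamma> q - real p) + D * \<epsilon> powr (\<delta> q - real r)"
        using *(5,6)[of \<epsilon>] \<epsilon> by (intro norm_triangle_le add_mono) auto
      also have "\<dots> \<le> C * \<epsilon> powr (\<kappa> q - real (p + r)) + D * \<epsilon> powr (\<kappa> q - real (p + r))"
        using * \<epsilon> by (intro add_mono mult_left_mono powr_mono') (auto simp: unit_interval_def \<kappa>_def)
      finally show ?thesis
        using \<phi> \<epsilon> by (simp add: algebra_simps moderate_ring_def)
    qed
    then show ?thesis
      using * by (intro exI[of _ "C + D"] conjI exI[of _ "min \<eta> \<theta>"]) auto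
  qed
  moreover have "\<kappa> \<in> growth_sequences"
    unfolding \<kappa>_def using p(1) r(1) by (rule growth_sequences_min)
  moreover have "v \<oplus>\<^bsub>moderate_ring\<^esub> w \<in> carrier moderate_ring"
    using assms by (auto simp: negligible_ideal_def moderate_ring_def moderate_add)
  ultimately show ?thesis
    unfolding negligible_ideal_def by blast
qed

lemma negligible_mult:
  assumes "v \<in> carrier moderate_ring" "w \<in> negligible_ideal"
  shows "v \<otimes>\<^bsub>moderate_ring\<^esub> w \<in> negligible_ideal"
proof -
  have "moderate v"
    using assms(1) by (simp add: moderate_ring_def)
  then obtain p where p: "\<And>\<phi>. \<phi> \<in> mollifiers p \<Longrightarrow> \<exists>C>0. \<exists>\<eta>>0. \<forall>\<epsilon>\<in>unit_interval. \<epsilon> < \<eta> \<longrightarrow>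
      norm (v (rescale \<epsilon> \<phi>)) \<le> C * \<epsilon> powr (- real p)"
    unfolding moderate_def by blast
  obtain r \<delta> where r: "\<delta> \<in> growth_sequences" "\<And>q \<phi>. q \<ge> r \<Longrightarrow> \<phi> \<in> mollifiers q \<Longrightarrow>
      \<exists>C>0. \<exists>\<eta>>0. \<forall>\<epsilon>\<in>unit_interval. \<epsilon> < \<eta> \<longrightarrow> norm (w (rescale \<epsilon> \<phi>)) \<le> C * \<epsilon> powr (\<delta> q - real r)"
    using assms(2) unfolding negligible_ideal_def by blast
  have "\<exists>C>0. \<exists>\<eta>>0. \<forall>\<epsilon>\<in>unit_interval. \<epsilon> < \<eta> \<longrightarrow>
      norm ((v \<otimes>\<^bsub>moderate_ring\<^esub> w) (rescale \<epsilon> \<phi>)) \<le> C * \<epsilon> powr (\<delta> q - real (p + r))"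
    if q: "q \<ge> p + r" and \<phi>: "\<phi> \<in> mollifiers q" for q \<phi>
  proof -
    have "\<phi> \<in> mollifiers p" "r \<le> q"
      using \<phi> q mollifiers_mono[of p q] by auto
    then obtain C \<eta> D \<theta> where *: "C > 0" "\<eta> > 0" "D > 0" "\<theta> > 0"
      "\<And>\<epsilon>. \<epsilon> \<in> unit_interval \<Longrightarrow> \<epsilon> < \<eta> \<Longrightarrow> norm (v (rescale \<epsilon> \<phi>)) \<le> C * \<epsilon> powr (- real p)"
      "\<And>\<epsilon>. \<epsilon> \<in> unit_interval \<Longrightarrow> \<epsilon> < \<theta> \<Longrightarrow> norm (w (rescale \<epsilon> \<phi>)) \<le> D * \<epsilon> powr (\<delta> q - real r)"
      using p r(2)[OF _ \<phi>] by metis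
    have "norm ((v \<otimes>\<^bsub>moderate_ring\<^esub> w) (rescale \<epsilon> \<phi>)) \<le> (C * D) * \<epsilon> powr (\<delta> q - real (p + r))"
      if \<epsilon>: "\<epsilon> \<in> unit_interval" "\<epsilon> < min \<eta> \<theta>" for \<epsilon>
    proof -
      have "norm (v (rescale \<epsilon> \<phi>) * w (rescale \<epsilon> \<phi>)) \<le>
          (C * \<epsilon> powr (- real p)) * (D * \<epsilon> powr (\<delta> q - real r))"
        unfolding norm_mult using *(5,6)[of \<epsilon>] * \<epsilon> by (intro mult_mono) auto
      also have "\<dots> = (C * D) * \<epsilon> powr (- real p + (\<delta> q - real r))"
        by (simp only: powr_add mult_ac)
      also have "- real p + (\<delta> q - real r) = \<delta> q - real (p + r)"
        by simp
      finally show ?thesis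
        using \<phi> \<epsilon> by (simp add: moderate_ring_def)
    qed
    then show ?thesis
      using * by (intro exI[of _ "C * D"] conjI exI[of _ "min \<eta> \<theta>"]) auto
  qed
  moreover have "v \<otimes>\<^bsub>moderate_ring\<^esub> w \<in> carrier moderate_ring"
    using assms by (auto simp: negligible_ideal_def moderate_ring_def moderate_mult)
  ultimately show ?thesis
    unfolding negligible_ideal_def using r(1) by blast
qed

theorem ideal_negligible:
  "ideal negligible_ideal (moderate_ring :: ((real \<Rightarrow> real) \<Rightarrow> 'a::real_normed_field) ring)"
proof -
  interpret cring "moderate_ring :: ((real \<Rightarrow> real) \<Rightarrow> 'a) ring"
    by (rule cring_moderate_ring)
  have sub: "negligible_ideal \<subseteq> carrier (moderate_ring :: ((real \<Rightarrow> real) \<Rightarrow> 'a) ring)"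
    by (auto simp: negligible_ideal_def)
  show ?thesis
  proof (rule idealI)
    show "subgroup negligible_ideal (add_monoid (moderate_ring :: ((real \<Rightarrow> real) \<Rightarrow> 'a) ring))"
    proof (rule add.subgroupI)
      fix v :: "(real \<Rightarrow> real) \<Rightarrow> 'a"
      assume v: "v \<in> negligible_ideal"
      then have "(\<ominus>\<^bsub>moderate_ring\<^esub> \<one>\<^bsub>moderate_ring\<^esub>) \<otimes>\<^bsub>moderate_ring\<^esub> v \<in> negligible_ideal"
        by (intro negligible_mult) auto
      then show "\<ominus>\<^bsub>moderate_ring\<^esub> v \<in> negligible_ideal"
        using v sub by (auto simp: l_minus subset_iff)
    qed (use sub negligible_zero negligible_add in auto)
    show "v \<otimes>\<^bsub>moderate_ring\<^esub> w \<in> negligible_ideal"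
      if "w \<in> negligible_ideal" "v \<in> carrier moderate_ring" for v w :: "(real \<Rightarrow> real) \<Rightarrow> 'a"
      using that by (rule negligible_mult[rotated])
    show "w \<otimes>\<^bsub>moderate_ring\<^esub> v \<in> negligible_ideal"
      if "w \<in> negligible_ideal" "v \<in> carrier moderate_ring" for v w :: "(real \<Rightarrow> real) \<Rightarrow> 'a"
      using that sub negligible_mult[of v w] by (simp add: m_comm subset_iff)
  qed (rule ring_axioms)
qed

end

theory Submission
  imports Defs
begin

text \<open>
  All three claims follow from a cycle of implications. If \<^term>\<open>x\<close> is not a unit, some
  representative \<^term>\<open>w\<close> has an oscillating zero set
  (\<open>nonunit_has_oscillating_representative\<close>). The indicator function of that zero set is an
  idempotent, its product with \<^term>\<open>w\<close> vanishes identically, and it is not negligible because on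
  mollifiers of every order it takes the value 1 for arbitrarily small dilations
  (\<open>oscillating_representative_gives_idempotent\<close>). Finally, an element that annihilates something
  nonzero cannot be a unit.

  The first implication carries the weight. Let \<^term>\<open>v\<close> represent a nonunit. If, for some
  \<^term>\<open>p\<close>, the values of \<^term>\<open>v\<close> along the dilations of every mollifier of order
  \<^term>\<open>p\<close> with support radius 1 were eventually bounded below by the \<^term>\<open>p\<close>-th power of the dilation parameter,
  then the pointwise inverse of \<^term>\<open>v\<close> would be moderate and \<^term>\<open>v\<close> would be invertible
  (\<open>generalized_class_in_Units\<close>). So for every \<^term>\<open>p\<close> there is a mollifier
  \<open>\<sigma> p\<close> of order \<^term>\<open>p\<close> along whose dilations \<^term>\<open>v\<close> is smaller than the
  \<^term>\<open>p\<close>-th power again and again. These places are split into two parts, each still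
  accumulating at zero on every orbit; \<^term>\<open>v\<close> is replaced by zero on the first part and by a
  nonzero value of the same smallness on the second.

  It remains to see that this perturbation is negligible (\<open>negligible_on_shapes\<close>). It only affects
  a mollifier of order \<^term>\<open>q\<close> if that lies on the orbit of some \<open>\<sigma> p\<close>, which is then of
  order \<^term>\<open>q\<close> as well. Since no test function is a mollifier of every order
  (\<open>ex_not_in_mollifiers\<close>), the least such \<^term>\<open>p\<close> tends to infinity with
  \<^term>\<open>q\<close>, and it serves as the rate of decay that negligibility asks for.
\<close>

section \<open>Neighbourhoods of zero on the right\<close>

lemma eventually_at_right_zero_unit_interval:
  "(\<forall>\<^sub>F \<epsilon> in at_right 0. P \<epsilon>) \<longleftrightarrow> (\<exists>\<eta>>0. \<forall>\<epsilon>\<in>unit_interval. \<epsilon> < \<eta> \<longrightarrow> P \<epsilon>)"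
proof
  assume "\<forall>\<^sub>F \<epsilon> in at_right 0. P \<epsilon>"
  then show "\<exists>\<eta>>0. \<forall>\<epsilon>\<in>unit_interval. \<epsilon> < \<eta> \<longrightarrow> P \<epsilon>"
    by (auto simp: eventually_at_right_field unit_interval_def)
next
  assume "\<exists>\<eta>>0. \<forall>\<epsilon>\<in>unit_interval. \<epsilon> < \<eta> \<longrightarrow> P \<epsilon>"
  then obtain \<eta> where "\<eta> > 0" "\<forall>\<epsilon>\<in>unit_interval. \<epsilon> < \<eta> \<longrightarrow> P \<epsilon>"
    by blast
  then show "\<forall>\<^sub>F \<epsilon> in at_right 0. P \<epsilon>"
    unfolding eventually_at_right_field
    by (intro exI[of _ "min \<eta> 1"]) (auto simp: unit_interval_def)
qed

lemma frequently_at_right_zero_iff: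
  "(\<exists>\<^sub>F t in at_right (0::real). P t) \<longleftrightarrow> (\<forall>\<eta>>0. \<exists>t>0. t < \<eta> \<and> P t)"
  unfolding frequently_def eventually_at_right_field by auto

lemma zero_in_closure_iff_frequently:
  "0 \<in> closure {\<epsilon> \<in> unit_interval. P \<epsilon>} \<longleftrightarrow> (\<exists>\<^sub>F \<epsilon> in at_right 0. P \<epsilon>)"
proof -
  have "0 \<in> closure {\<epsilon> \<in> unit_interval. P \<epsilon>} \<longleftrightarrow> (\<forall>\<eta>>0. \<exists>\<epsilon>\<in>unit_interval. \<epsilon> < \<eta> \<and> P \<epsilon>)"
    unfolding closure_approachable by (auto simp: unit_interval_def dist_real_def Bex_def)
  then show ?thesis
    unfolding frequently_def eventually_at_right_zero_unit_interval by auto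
qed

lemma oscillating_sets_iff_frequently:
  "{\<epsilon> \<in> unit_interval. P \<epsilon>} \<in> oscillating_sets \<longleftrightarrow>
     (\<exists>\<^sub>F \<epsilon> in at_right 0. P \<epsilon>) \<and> (\<exists>\<^sub>F \<epsilon> in at_right 0. \<not> P \<epsilon>)"
proof -
  have "unit_interval - {\<epsilon> \<in> unit_interval. P \<epsilon>} = {\<epsilon> \<in> unit_interval. \<not> P \<epsilon>}"
    by auto
  then show ?thesis
    unfolding oscillating_sets_def mem_Collect_eq Int_iff zero_in_closure_iff_frequently[symmetric]
    by auto
qed

lemma eventually_at_right_zero_scale:
  assumes "(c::real) > 0"
  shows "(\<forall>\<^sub>F t in at_right 0. P (c * t)) \<longleftrightarrow> (\<forall>\<^sub>F t in at_right 0. P t)"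
  using filtermap_times_pos_at_right[OF assms, of 0]
  by (metis eventually_filtermap mult_zero_right)

lemma eventually_scale_less_at_right_zero:
  assumes "(c::real) > 0" "r > 0"
  shows "\<forall>\<^sub>F t in at_right 0. c * t < r"
  using eventually_at_right_zero_scale[of c "\<lambda>t. t < r"] assms
    eventually_at_right_real[of 0 r] by (auto elim: eventually_mono)

text \<open>
  Pick a sequence decreasing to zero at whose members the property holds, and separate the members of
  even index from those of odd index.
\<close>

lemma frequently_split:
  assumes "\<exists>\<^sub>F t in at_right (0::real). P t"
  shows "\<exists>Q. (\<exists>\<^sub>F t in at_right 0. P t \<and> Q t) \<and> (\<exists>\<^sub>F t in at_right 0. P t \<and> \<not> Q t)"
proof -
  have freq: "\<exists>t>0. t < \<eta> \<and> P t" if "\<eta> > 0" for \<eta>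
    using assms that unfolding frequently_at_right_zero_iff by blast
  obtain f where f: "\<And>n. 0 < f n \<and> P (f n)" and step: "\<And>n. f (Suc n) < f n / 2"
  proof -
    have "\<exists>t. 0 < t \<and> P t"
      using freq[of 1] by auto
    moreover have "\<exists>t. (0 < t \<and> P t) \<and> t < s / 2" if "0 < s \<and> P s" for s
      using freq[of "s / 2"] that by auto
    ultimately show ?thesis
      using that dependent_nat_choice[of "\<lambda>_ t. 0 < t \<and> P t" "\<lambda>_ s t. t < s / 2"] by blast
  qed
  have "f (Suc n) < f n" for n
    using step[of n] f[of n] by linarith
  then have "strict_mono (\<lambda>n. - f n)"
    by (intro strict_mono_Suc_iff[THEN iffD2]) simp
  then have inj: "f m = f n \<longleftrightarrow> m = n" for m n
    using strict_mono_eq by fastforce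
  have bound: "f n \<le> f 0 * (1 / 2) ^ n" for n
  proof (induction n)
    case (Suc n)
    then show ?case using step[of n] by simp
  qed simp
  have lim: "(\<lambda>n. f 0 * (1 / 2) ^ n) \<longlonglongrightarrow> 0"
    by (intro tendsto_mult_right_zero LIMSEQ_realpow_zero) auto
  have small: "\<exists>N. \<forall>n\<ge>N. f n < \<eta>" if "\<eta> > 0" for \<eta>
    using order_tendstoD(2)[OF lim that] bound
    unfolding eventually_sequentially by (meson order_le_less_trans)
  show ?thesis
  proof (intro exI[of _ "\<lambda>t. \<exists>n. t = f (2 * n)"] conjI)
    show "\<exists>\<^sub>F t in at_right 0. P t \<and> (\<exists>n. t = f (2 * n))"
      unfolding frequently_at_right_zero_iff
    proof (intro allI impI)
      fix \<eta> :: real assume "\<eta> > 0"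
      from small[OF this] obtain N where "\<forall>n\<ge>N. f n < \<eta>" ..
      then have "f (2 * N) < \<eta>" by simp
      then show "\<exists>t>0. t < \<eta> \<and> P t \<and> (\<exists>n. t = f (2 * n))"
        using f by blast
    qed
    show "\<exists>\<^sub>F t in at_right 0. P t \<and> (\<nexists>n. t = f (2 * n))"
      unfolding frequently_at_right_zero_iff
    proof (intro allI impI)
      fix \<eta> :: real assume "\<eta> > 0"
      from small[OF this] obtain N where "\<forall>n\<ge>N. f n < \<eta>" ..
      then have "f (Suc (2 * N)) < \<eta>" by simp
      moreover have "\<nexists>n. f (Suc (2 * N)) = f (2 * n)"
        unfolding inj by presburger
      ultimately show "\<exists>t>0. t < \<eta> \<and> P t \<and> (\<nexists>n. t = f (2 * n))"
        using f by blast
    qed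
  qed
qed

section \<open>Dilation orbits of test functions\<close>

lemma rescale_rescale [simp]: "rescale a (rescale b \<phi>) = rescale (a * b) \<phi>"
  by (simp add: rescale_def fun_eq_iff mult.commute)

lemma rescale_one [simp]: "rescale 1 \<phi> = \<phi>"
  by (simp add: rescale_def)

text \<open>
  The radius of the support scales linearly under dilation, so it serves as the coordinate on a
  dilation orbit. In particular the dilation parameter can be recovered from a dilated function.
\<close>

definition support_radius :: "(real \<Rightarrow> real) \<Rightarrow> real" where
  "support_radius \<phi> = Sup {x. \<phi> x \<noteq> 0}"

text \<open>
  The shape is the point of radius 1 on the orbit. Any choice that depends on a test function only
  through its shape is the same along the whole orbit, even if the orbit is met through several of
  its members.
\<close>

definition shape :: "(real \<Rightarrow> real) \<Rightarrow> (real \<Rightarrow> real)" where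
  "shape \<phi> = rescale (1 / support_radius \<phi>) \<phi>"

lemma test_function_support:
  assumes "\<phi> \<in> test_functions"
  shows "\<exists>x>0. \<phi> x \<noteq> 0" "bdd_above {x. \<phi> x \<noteq> 0}"
proof -
  show "\<exists>x>0. \<phi> x \<noteq> 0"
  proof (rule ccontr)
    assume "\<not> (\<exists>x>0. \<phi> x \<noteq> 0)"
    then have "\<phi> x = 0" if "x \<in> {0..} - {0}" for x
      using that by (auto simp: order_less_le)
    then have "integral {0..} (\<lambda>x::real. 0) = integral {0..} \<phi>"
      by (rule integral_spike[OF negligible_sing])
    then show False
      using assms by (simp add: test_functions_def)
  qed
  obtain b where "\<And>x. x > b \<Longrightarrow> \<phi> x = 0"
    using test_functions_vanish[OF assms] by blast
  then show "bdd_above {x. \<phi> x \<noteq> 0}"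
    by (intro bdd_aboveI[of _ b]) (metis mem_Collect_eq not_le)
qed

lemma support_radius_pos:
  assumes "\<phi> \<in> test_functions"
  shows "support_radius \<phi> > 0"
proof -
  obtain x where "x > 0" "\<phi> x \<noteq> 0"
    using test_function_support(1)[OF assms] by blast
  then have "x \<le> support_radius \<phi>"
    unfolding support_radius_def using test_function_support(2)[OF assms] by (intro cSup_upper) auto
  with \<open>x > 0\<close> show ?thesis
    by linarith
qed

lemma support_radius_rescale:
  assumes "\<phi> \<in> test_functions" "a > 0"
  shows "support_radius (rescale a \<phi>) = a * support_radius \<phi>"
proof -
  have "{x. rescale a \<phi> x \<noteq> 0} = (\<lambda>x. a * x) ` {x. \<phi> x \<noteq> 0}"
    using assms(2) by (auto simp: rescale_def image_iff intro!: exI[of _ "_ / a"])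
  moreover have "a * Sup {x. \<phi> x \<noteq> 0} = (SUP x\<in>{x. \<phi> x \<noteq> 0}. a * x)"
    using assms test_function_support[OF assms(1)]
    by (intro continuous_at_Sup_mono) (auto intro!: monoI continuous_intros)
  ultimately show ?thesis
    by (simp add: support_radius_def)
qed

lemma shape_rescale [simp]:
  assumes "\<phi> \<in> test_functions" "a > 0"
  shows "shape (rescale a \<phi>) = shape \<phi>"
  using assms support_radius_pos[OF assms(1)]
  by (simp add: shape_def support_radius_rescale)

lemma rescale_eq_rescale_shape:
  assumes "\<phi> \<in> test_functions"
  shows "rescale a \<phi> = rescale (support_radius \<phi> * a) (shape \<phi>)"
  using support_radius_pos[OF assms] by (simp add: shape_def)

lemma shape_in_mollifiers:
  assumes "\<phi> \<in> mollifiers q"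
  shows "shape \<phi> \<in> mollifiers q"
  using assms support_radius_pos[of \<phi>] rescale_mollifiers[of \<phi> q "1 / support_radius \<phi>"]
  by (simp add: shape_def mollifiers_def)

lemma support_radius_shape [simp]:
  assumes "\<phi> \<in> test_functions"
  shows "support_radius (shape \<phi>) = 1"
  using support_radius_pos[OF assms] assms by (simp add: shape_def support_radius_rescale)

lemma shape_eq_self:
  assumes "support_radius \<phi> = 1"
  shows "shape \<phi> = \<phi>"
  using assms by (simp add: shape_def)

section \<open>No test function has all vanishing moments\<close>

lemma test_functions_continuous:
  assumes "\<phi> \<in> test_functions"
  shows "continuous_on A \<phi>"
proof -
  have "(deriv ^^ 0) \<phi> differentiable_on UNIV"
    using assms unfolding test_functions_def smooth_def by blast
  then show ?thesis
    using continuous_on_subset[OF differentiable_imp_continuous_on] by fastforce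
qed

lemma integrable_on_half_line_bounded_support:
  fixes f :: "real \<Rightarrow> real"
  assumes "continuous_on {0..b} f" "\<And>x. x > b \<Longrightarrow> f x = 0"
  shows "f integrable_on {0..}"
proof -
  have "f integrable_on {0..b}"
    using assms(1) by (rule integrable_continuous_real)
  moreover have "(f has_integral i) {0..b} \<longleftrightarrow> (f has_integral i) {0..}" for i
    by (rule has_integral_spike_set_eq) (auto intro!: negligible_subset[of "{}"] simp: assms(2))
  ultimately show ?thesis
    by (simp add: integrable_on_def)
qed

text \<open>
  The functions \<open>x powr (1 / m)\<close> tend to 1 away from the origin and stay bounded on the compact
  support, so dominated convergence compares the fractional moments with the normalization
  \<open>integral {0..} \<phi> = 1 / 2\<close>.
\<close>

lemma tendsto_root_moments:
  assumes "\<phi> \<in> test_functions"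
  shows "(\<lambda>m. integral {0..} (\<lambda>x. x powr (1 / real (Suc m)) * \<phi> x)) \<longlonglongrightarrow> 1 / 2"
proof -
  obtain b where b: "\<And>x. x > b \<Longrightarrow> \<phi> x = 0"
    using test_functions_vanish[OF assms] by blast
  define c where "c = max 1 b"
  note cont = test_functions_continuous[OF assms]
  have "(\<lambda>m. integral {0..} (\<lambda>x. x powr (1 / real (Suc m)) * \<phi> x)) \<longlonglongrightarrow>
      integral {0..} (\<lambda>x. if x = 0 then 0 else \<phi> x)"
    \<comment> \<open>At the origin \<open>0 powr a = 0\<close> for every exponent, hence the case distinction in the limit.\<close>
  proof (rule dominated_convergence(2))
    show "(\<lambda>x. x powr (1 / real (Suc m)) * \<phi> x) integrable_on {0..}" for m
      using b by (intro integrable_on_half_line_bounded_support[of c])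
        (auto simp: c_def intro!: continuous_intros continuous_on_powr' cont)
    show "(\<lambda>x. c * \<bar>\<phi> x\<bar>) integrable_on {0..}"
      using b by (intro integrable_on_half_line_bounded_support[of c])
        (auto simp: c_def intro!: continuous_intros cont)
    show "norm (x powr (1 / real (Suc m)) * \<phi> x) \<le> c * \<bar>\<phi> x\<bar>" if "x \<in> {0..}" for m x
    proof (cases "x > b")
      case False
      have "x powr (1 / real (Suc m)) \<le> c powr (1 / real (Suc m))"
        using that False by (intro powr_mono2) (auto simp: c_def)
      also have "\<dots> \<le> c powr 1"
        by (intro powr_mono) (auto simp: c_def)
      finally show ?thesis
        by (simp add: abs_mult mult_right_mono c_def)
    qed (simp add: b)
    show "(\<lambda>m. x powr (1 / real (Suc m)) * \<phi> x) \<longlonglongrightarrow> (if x = 0 then 0 else \<phi> x)"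
      if "x \<in> {0..}" for x
    proof (cases "x = 0")
      case False
      have "(\<lambda>m. 1 / real (Suc m)) \<longlonglongrightarrow> 0"
        using LIMSEQ_inverse_real_of_nat by (simp add: inverse_eq_divide)
      then have "(\<lambda>m. x powr (1 / real (Suc m)) * \<phi> x) \<longlonglongrightarrow> x powr 0 * \<phi> x"
        using False by (intro tendsto_intros) auto
      then show ?thesis
        using False by simp
    qed simp
  qed
  also have "integral {0..} (\<lambda>x. if x = 0 then 0 else \<phi> x) = integral {0..} \<phi>"
    by (rule integral_spike[OF negligible_sing[of 0]]) auto
  also have "\<dots> = 1 / 2"
    using assms by (simp add: test_functions_def)
  finally show ?thesis .
qed

text \<open>
  If the moments with exponents \<open>1 / m\<close> all vanished, so would their limit \<open>1 / 2\<close>.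
\<close>

lemma ex_not_in_mollifiers: "\<exists>n. \<phi> \<notin> mollifiers n"
proof (rule ccontr)
  assume "\<not> ?thesis"
  then have all: "\<phi> \<in> mollifiers n" for n
    by blast
  have "integral {0..} (\<lambda>x. x powr (real j / real k) * \<phi> x) = 0"
    if "1 \<le> j" "j \<le> q" "1 \<le> k" "k \<le> q" for q j k
    using all[of q] that unfolding mollifiers_def by blast
  from this[of 1 _ "Suc _"]
  have "integral {0..} (\<lambda>x. x powr (1 / real (Suc m)) * \<phi> x) = 0" for m
    by (metis le_add1 le_refl of_nat_1 plus_1_eq_Suc)
  then have "(\<lambda>m. 0) \<longlonglongrightarrow> (1 / 2 :: real)"
    using tendsto_root_moments[of \<phi>] all[of 0] by (simp add: mollifiers_def)
  then show False
    by (simp add: LIMSEQ_const_iff)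
qed

section \<open>Cosets of generalized numbers\<close>

abbreviation generalized_class ::
    "((real \<Rightarrow> real) \<Rightarrow> 'a::real_normed_field) \<Rightarrow> ((real \<Rightarrow> real) \<Rightarrow> 'a) set" where
  "generalized_class v \<equiv> negligible_ideal +>\<^bsub>moderate_ring\<^esub> v"

lemma moderate_ring_carrier_iff:
  "v \<in> carrier moderate_ring \<longleftrightarrow> v \<in> extensional test_functions \<and> moderate v"
  by (simp add: moderate_ring_def)

lemma moderate_iff_eventually:
  "moderate v \<longleftrightarrow> (\<exists>p::nat. \<forall>\<phi>\<in>mollifiers p. \<exists>C>0.
     \<forall>\<^sub>F \<epsilon> in at_right 0. norm (v (rescale \<epsilon> \<phi>)) \<le> C * \<epsilon> powr (- real p))"
  unfolding moderate_def eventually_at_right_zero_unit_interval ..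

lemma eventually_in_unit_interval:
  "\<forall>\<^sub>F \<epsilon> in at_right (0::real). 0 < \<epsilon> \<and> \<epsilon> < 1"
  using eventually_at_right_real[of 0 1] by (auto elim: eventually_mono)

text \<open>
  Moderateness comes for free: growth sequences are nonnegative, so the estimate for \<open>q = p\<close> bounds
  \<^term>\<open>v\<close> by a multiple of the power with exponent \<open>- p\<close>.
\<close>

lemma negligible_idealI:
  fixes v :: "(real \<Rightarrow> real) \<Rightarrow> 'a::real_normed_field"
  assumes ext: "v \<in> extensional test_functions" and \<gamma>: "\<gamma> \<in> growth_sequences"
    and bound: "\<And>q \<phi>. q \<ge> p \<Longrightarrow> \<phi> \<in> mollifiers q \<Longrightarrow>
      \<exists>C>0. \<forall>\<^sub>F \<epsilon> in at_right 0. norm (v (rescale \<epsilon> \<phi>)) \<le> C * \<epsilon> powr (\<gamma> q - real p)"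
  shows "v \<in> negligible_ideal"
proof -
  have "moderate v"
    unfolding moderate_iff_eventually
  proof (intro exI[of _ p] ballI)
    fix \<phi> assume "\<phi> \<in> mollifiers p"
    then obtain C where C: "C > 0"
      "\<forall>\<^sub>F \<epsilon> in at_right 0. norm (v (rescale \<epsilon> \<phi>)) \<le> C * \<epsilon> powr (\<gamma> p - real p)"
      using bound by blast
    have "\<forall>\<^sub>F \<epsilon> in at_right 0. norm (v (rescale \<epsilon> \<phi>)) \<le> C * \<epsilon> powr (- real p)"
      using C(2) eventually_in_unit_interval
    proof eventually_elim
      case (elim \<epsilon>)
      have "\<epsilon> powr (\<gamma> p - real p) \<le> \<epsilon> powr (- real p)"
        using elim(2) \<gamma> by (intro powr_mono') (auto simp: growth_sequences_def)
      then have "C * \<epsilon> powr (\<gamma> p - real p) \<le> C * \<epsilon> powr (- real p)"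
        using C(1) by simp
      with elim(1) show ?case
        by linarith
    qed
    with C(1) show "\<exists>C>0. \<forall>\<^sub>F \<epsilon> in at_right 0. norm (v (rescale \<epsilon> \<phi>)) \<le> C * \<epsilon> powr (- real p)"
      by blast
  qed
  then show ?thesis
    using ext \<gamma> bound
    unfolding negligible_ideal_def moderate_ring_carrier_iff
      eventually_at_right_zero_unit_interval[symmetric] mem_Collect_eq by blast
qed

lemma generalized_class_carrier:
  assumes "v \<in> carrier moderate_ring"
  shows "generalized_class v \<in> carrier generalized_numbers"
  using assms by (auto simp: generalized_numbers_def FactRing_def A_RCOSETS_def')

lemma generalized_numbers_cases:
  assumes "x \<in> carrier generalized_numbers"
  obtains v where "v \<in> carrier moderate_ring" "x = generalized_class v"
  using assms by (auto simp: generalized_numbers_def FactRing_def A_RCOSETS_def')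

lemma generalized_class_mult:
  fixes v w :: "(real \<Rightarrow> real) \<Rightarrow> 'a::real_normed_field"
  assumes "v \<in> carrier moderate_ring" "w \<in> carrier moderate_ring"
  shows "generalized_class v \<otimes>\<^bsub>generalized_numbers\<^esub> generalized_class w =
    generalized_class (\<lambda>\<phi>\<in>test_functions. v \<phi> * w \<phi>)"
proof -
  have "generalized_class v \<otimes>\<^bsub>generalized_numbers\<^esub> generalized_class w =
      generalized_class (v \<otimes>\<^bsub>moderate_ring\<^esub> w)"
    unfolding generalized_numbers_def FactRing_def
    using ideal.rcoset_mult_add[OF ideal_negligible assms] by simp
  then show ?thesis
    by (simp add: moderate_ring_def)
qed

lemma generalized_class_one:
  "\<one>\<^bsub>generalized_numbers\<^esub> = generalized_class (\<lambda>\<phi>\<in>test_functions. 1)"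
  by (simp add: generalized_numbers_def FactRing_def moderate_ring_def)

lemma generalized_class_eq_zero_iff:
  fixes v :: "(real \<Rightarrow> real) \<Rightarrow> 'a::real_normed_field"
  assumes "v \<in> carrier moderate_ring"
  shows "generalized_class v = \<zero>\<^bsub>generalized_numbers\<^esub> \<longleftrightarrow> v \<in> negligible_ideal"
proof -
  interpret ideal negligible_ideal "moderate_ring :: ((real \<Rightarrow> real) \<Rightarrow> 'a) ring"
    by (rule ideal_negligible)
  show ?thesis
    using a_rcos_self[OF assms] a_rcos_const[of v]
    by (auto simp: generalized_numbers_def FactRing_def)
qed

lemma cring_generalized_numbers:
  "cring (generalized_numbers :: ((real \<Rightarrow> real) \<Rightarrow> 'a::real_normed_field) set ring)"
  unfolding generalized_numbers_def
  using ideal.quotient_is_cring[OF ideal_negligible cring_moderate_ring] .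

lemma representative_iff:
  fixes v w :: "(real \<Rightarrow> real) \<Rightarrow> 'a::real_normed_field"
  assumes "v \<in> carrier moderate_ring"
  shows "representative w (generalized_class v) \<longleftrightarrow>
    w \<in> carrier moderate_ring \<and> generalized_class w = generalized_class v"
proof -
  interpret ideal negligible_ideal "moderate_ring :: ((real \<Rightarrow> real) \<Rightarrow> 'a) ring"
    by (rule ideal_negligible)
  show ?thesis
    unfolding representative_def
    using a_repr_independence[OF _ assms a_subgroup] a_rcos_self[of w] by metis
qed

lemma representative_perturb:
  fixes u v w :: "(real \<Rightarrow> real) \<Rightarrow> 'a::real_normed_field"
  assumes v: "v \<in> carrier moderate_ring" and u: "u \<in> negligible_ideal"
    and w: "w \<in> extensional test_functions"
    and sum: "\<And>\<phi>. \<phi> \<in> test_functions \<Longrightarrow> w \<phi> = u \<phi> + v \<phi>"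
  shows "representative w (generalized_class v)"
proof -
  interpret ideal negligible_ideal "moderate_ring :: ((real \<Rightarrow> real) \<Rightarrow> 'a) ring"
    by (rule ideal_negligible)
  have "w = u \<oplus>\<^bsub>moderate_ring\<^esub> v"
    using w sum by (auto simp: moderate_ring_def fun_eq_iff extensional_def)
  then show ?thesis
    using u v a_Hcarr[OF u] unfolding representative_def a_r_coset_def' by auto
qed

section \<open>Invertibility\<close>

text \<open>
  The inverse is represented by the pointwise inverse of \<^term>\<open>v\<close>, with value 0 at the zeros of
  \<^term>\<open>v\<close>. The lower bound makes it moderate, and it also keeps the zeros away from all
  sufficiently small dilations of a mollifier of order \<^term>\<open>p\<close>, so that the defect of the
  product, a function supported on the zeros, is negligible. It is enough to assume the bound at
  shapes, since passing to another member of the orbit only changes the constant.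
\<close>

lemma generalized_class_in_Units:
  fixes v :: "(real \<Rightarrow> real) \<Rightarrow> 'a::real_normed_field"
  assumes v: "v \<in> carrier moderate_ring"
    and bound: "\<And>\<sigma>. \<sigma> \<in> mollifiers p \<Longrightarrow> support_radius \<sigma> = 1 \<Longrightarrow>
      \<forall>\<^sub>F t in at_right 0. t ^ p \<le> norm (v (rescale t \<sigma>))"
  shows "generalized_class v \<in> Units generalized_numbers"
proof -
  define w where "w = (\<lambda>\<phi>\<in>test_functions. inverse (v \<phi>))"
  define u :: "(real \<Rightarrow> real) \<Rightarrow> 'a" where
    "u = (\<lambda>\<phi>\<in>test_functions. if v \<phi> = 0 then 1 else 0)"
  have lower: "\<forall>\<^sub>F \<epsilon> in at_right 0. 0 < \<epsilon> \<and> rescale \<epsilon> \<phi> \<in> test_functions \<and>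
      (support_radius \<phi> * \<epsilon>) ^ p \<le> norm (v (rescale \<epsilon> \<phi>))"
    and radius: "support_radius \<phi> > 0"
    if \<phi>: "\<phi> \<in> mollifiers p" for \<phi>
  proof -
    have test: "\<phi> \<in> test_functions"
      using \<phi> by (simp add: mollifiers_def)
    show R: "support_radius \<phi> > 0"
      using test by (rule support_radius_pos)
    have "\<forall>\<^sub>F t in at_right 0. t ^ p \<le> norm (v (rescale t (shape \<phi>)))"
      using \<phi> test by (intro bound shape_in_mollifiers support_radius_shape)
    then have "\<forall>\<^sub>F \<epsilon> in at_right 0. (support_radius \<phi> * \<epsilon>) ^ p \<le> norm (v (rescale \<epsilon> \<phi>))"
      using eventually_at_right_zero_scale[OF R, of "\<lambda>t. t ^ p \<le> norm (v (rescale t (shape \<phi>)))"]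
      by (simp add: rescale_eq_rescale_shape[OF test, symmetric])
    then show "\<forall>\<^sub>F \<epsilon> in at_right 0. 0 < \<epsilon> \<and> rescale \<epsilon> \<phi> \<in> test_functions \<and>
        (support_radius \<phi> * \<epsilon>) ^ p \<le> norm (v (rescale \<epsilon> \<phi>))"
      using eventually_in_unit_interval
      by eventually_elim (use test in \<open>auto intro: rescale_test_functions\<close>)
  qed
  have "moderate w"
    unfolding moderate_iff_eventually
  proof (intro exI[of _ p] ballI exI conjI)
    fix \<phi> assume \<phi>: "\<phi> \<in> mollifiers p"
    let ?R = "support_radius \<phi>"
    show "inverse (?R ^ p) > 0"
      using radius[OF \<phi>] by simp
    show "\<forall>\<^sub>F \<epsilon> in at_right 0. norm (w (rescale \<epsilon> \<phi>)) \<le> inverse (?R ^ p) * \<epsilon> powr (- real p)"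
      using lower[OF \<phi>]
    proof eventually_elim
      case (elim \<epsilon>)
      then have "norm (w (rescale \<epsilon> \<phi>)) \<le> inverse ((?R * \<epsilon>) ^ p)"
        using radius[OF \<phi>] by (auto simp: w_def norm_inverse intro!: le_imp_inverse_le)
      also have "\<dots> = inverse (?R ^ p) * \<epsilon> powr (- real p)"
        using elim by (simp add: power_mult_distrib powr_minus powr_realpow)
      finally show ?case .
    qed
  qed
  then have w: "w \<in> carrier moderate_ring"
    by (simp add: moderate_ring_carrier_iff w_def)
  have u: "u \<in> negligible_ideal"
  proof (rule negligible_idealI)
    show "u \<in> extensional test_functions"
      by (simp add: u_def)
    show "real \<in> growth_sequences"
      by (simp add: growth_sequences_def strict_mono_def filterlim_real_sequentially)
    show "\<exists>C>0. \<forall>\<^sub>F \<epsilon> in at_right 0. norm (u (rescale \<epsilon> \<phi>)) \<le> C * \<epsilon> powr (real q - real p)"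
      if "q \<ge> p" "\<phi> \<in> mollifiers q" for q \<phi>
    proof (intro exI[of _ 1] conjI)
      have \<phi>: "\<phi> \<in> mollifiers p"
        using that mollifiers_mono by blast
      show "\<forall>\<^sub>F \<epsilon> in at_right 0. norm (u (rescale \<epsilon> \<phi>)) \<le> 1 * \<epsilon> powr (real q - real p)"
        using lower[OF \<phi>]
      proof eventually_elim
        case (elim \<epsilon>)
        then have "0 < (support_radius \<phi> * \<epsilon>) ^ p"
          using radius[OF \<phi>] by simp
        with elim have "v (rescale \<epsilon> \<phi>) \<noteq> 0"
          by auto
        then show ?case
          using elim by (simp add: u_def)
      qed
    qed simp
  qed
  let ?vw = "\<lambda>\<phi>\<in>test_functions. v \<phi> * w \<phi>"
  have vw: "?vw \<in> carrier moderate_ring"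
    using v w by (simp add: moderate_ring_carrier_iff moderate_mult)
  have "representative (\<lambda>\<phi>\<in>test_functions. 1) (generalized_class ?vw)"
    using vw u by (rule representative_perturb) (auto simp: u_def w_def)
  then have "generalized_class ?vw = \<one>\<^bsub>generalized_numbers\<^esub>"
    by (simp only: representative_iff[OF vw] generalized_class_one)
  then have inv: "generalized_class v \<otimes>\<^bsub>generalized_numbers\<^esub> generalized_class w =
      \<one>\<^bsub>generalized_numbers\<^esub>"
    by (simp only: generalized_class_mult[OF v w])
  interpret cring "generalized_numbers :: ((real \<Rightarrow> real) \<Rightarrow> 'a) set ring"
    by (rule cring_generalized_numbers)
  note carrier = generalized_class_carrier[OF v] generalized_class_carrier[OF w]
  have "generalized_class w \<otimes>\<^bsub>generalized_numbers\<^esub> generalized_class v =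
      \<one>\<^bsub>generalized_numbers\<^esub>"
    using inv m_comm[OF carrier] by simp
  with inv carrier show ?thesis
    unfolding Units_def by blast
qed

section \<open>Perturbation to an oscillating zero set\<close>

text \<open>
  A growth sequence must increase strictly, whereas the rates found below are merely monotone. The
  strictly increasing correction \<open>1 - 1 / (q + 1)\<close> repairs this; as it stays below 1, it is absorbed
  by the shift \<open>p\<close> in the exponent \<open>\<gamma> q - p\<close>.
\<close>

lemma growth_sequences_of_mono:
  fixes g :: "nat \<Rightarrow> nat"
  assumes "mono g" "filterlim g at_top sequentially"
  shows "(\<lambda>q. real (g q) + (1 - 1 / real (Suc q))) \<in> growth_sequences"
proof -
  have "strict_mono (\<lambda>q. real (g q) + (1 - 1 / real (Suc q)))"
  proof (rule strict_monoI)
    fix q r :: nat assume "q < r"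
    then have "g q \<le> g r" "1 / real (Suc r) < 1 / real (Suc q)"
      using monoD[OF assms(1), of q r] by (auto intro!: divide_strict_left_mono)
    then show "real (g q) + (1 - 1 / real (Suc q)) < real (g r) + (1 - 1 / real (Suc r))"
      by linarith
  qed
  moreover have frac: "0 \<le> 1 - 1 / real (Suc q)" for q
    by simp
  moreover have "filterlim (\<lambda>q. real (g q) + (1 - 1 / real (Suc q))) at_top sequentially"
    by (rule filterlim_at_top_mono[OF filterlim_compose[OF filterlim_real_sequentially assms(2)]])
      (use frac in simp)
  ultimately show ?thesis
    by (simp add: growth_sequences_def)
qed

text \<open>
  Each single \<open>\<sigma> p\<close> drops out of the mollifiers of order \<^term>\<open>q\<close> once \<^term>\<open>q\<close> is large,
  hence so do any finitely many of them.
\<close>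

lemma filterlim_first_index_at_top:
  assumes "\<And>p. \<exists>n. \<sigma> p \<notin> mollifiers n" "\<And>q. \<sigma> q \<in> mollifiers q"
  shows "filterlim (\<lambda>q. LEAST p. \<sigma> p \<in> mollifiers q) at_top sequentially"
  unfolding filterlim_at_top
proof
  fix P :: nat
  have "\<forall>\<^sub>F q in sequentially. \<sigma> p \<notin> mollifiers q" for p
    using assms(1)[of p] mollifiers_mono unfolding eventually_sequentially by blast
  then have "\<forall>\<^sub>F q in sequentially. \<forall>p\<in>{..<P}. \<sigma> p \<notin> mollifiers q"
    by (intro eventually_ball_finite) auto
  then show "\<forall>\<^sub>F q in sequentially. P \<le> (LEAST p. \<sigma> p \<in> mollifiers q)"
  proof eventually_elim
    case (elim q)
    have "\<sigma> (LEAST p. \<sigma> p \<in> mollifiers q) \<in> mollifiers q"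
      using assms(2) by (rule LeastI)
    with elim show ?case
      by (meson lessThan_iff not_le)
  qed
qed

text \<open>
  On the orbit of a mollifier of order \<^term>\<open>q\<close>, a nonzero value of \<^term>\<open>u\<close> comes with an
  index \<^term>\<open>p\<close> such that \<open>\<sigma> p\<close> is a mollifier of order \<^term>\<open>q\<close>. That index may vary along
  the orbit, but it is never smaller than the first such index \<open>g q\<close>, and for radius below 1 the
  power with the smaller exponent is the weaker bound.
\<close>

lemma negligible_on_shapes:
  fixes u :: "(real \<Rightarrow> real) \<Rightarrow> 'a::real_normed_field"
  assumes ext: "u \<in> extensional test_functions"
    and \<sigma>: "\<And>p. \<sigma> p \<in> mollifiers p"
    and small: "\<And>\<psi>. \<psi> \<in> test_functions \<Longrightarrow> u \<psi> \<noteq> 0 \<Longrightarrow>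
      \<exists>p. shape \<psi> = \<sigma> p \<and> norm (u \<psi>) \<le> 2 * support_radius \<psi> ^ p"
  shows "u \<in> negligible_ideal"
proof -
  define g where "g = (\<lambda>q. LEAST p. \<sigma> p \<in> mollifiers q)"
  have g_le: "g q \<le> p" if "\<sigma> p \<in> mollifiers q" for p q
    unfolding g_def using that by (rule Least_le)
  have "mono g"
  proof (rule monoI)
    fix q r :: nat assume "q \<le> r"
    have "\<sigma> (g r) \<in> mollifiers r"
      unfolding g_def using \<sigma> by (rule LeastI)
    then show "g q \<le> g r"
      using mollifiers_mono[OF \<open>q \<le> r\<close>] by (intro g_le) blast
  qed
  moreover have "filterlim g at_top sequentially"
    unfolding g_def by (rule filterlim_first_index_at_top[OF ex_not_in_mollifiers \<sigma>])
  ultimately have growth: "(\<lambda>q. real (g q) + (1 - 1 / real (Suc q))) \<in> growth_sequences"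
    by (rule growth_sequences_of_mono)
  show ?thesis
  proof (rule negligible_idealI[OF ext growth, of 1])
    fix q \<phi> assume \<phi>: "\<phi> \<in> mollifiers q"
    then have test: "\<phi> \<in> test_functions"
      by (simp add: mollifiers_def)
    let ?R = "support_radius \<phi>"
    have R: "?R > 0"
      using test by (rule support_radius_pos)
    have "\<forall>\<^sub>F \<epsilon> in at_right 0. norm (u (rescale \<epsilon> \<phi>)) \<le>
        (2 * ?R ^ g q) * \<epsilon> powr (real (g q) + (1 - 1 / real (Suc q)) - real 1)"
      using eventually_in_unit_interval eventually_scale_less_at_right_zero[OF R zero_less_one]
    proof eventually_elim
      case (elim \<epsilon>)
      show ?case
      proof (cases "u (rescale \<epsilon> \<phi>) = 0")
        case False
        then obtain p where p: "shape \<phi> = \<sigma> p" "norm (u (rescale \<epsilon> \<phi>)) \<le> 2 * (?R * \<epsilon>) ^ p"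
          using small[of "rescale \<epsilon> \<phi>"] elim test
          by (auto simp: rescale_test_functions support_radius_rescale mult.commute)
        have "g q \<le> p"
          using shape_in_mollifiers[OF \<phi>] p(1) by (intro g_le) simp
        then have "(?R * \<epsilon>) ^ p \<le> (?R * \<epsilon>) ^ g q"
          using elim R by (intro power_decreasing) auto
        with p(2) have "norm (u (rescale \<epsilon> \<phi>)) \<le> 2 * ?R ^ g q * \<epsilon> powr real (g q)"
          using elim by (simp add: power_mult_distrib powr_realpow)
        also have "\<dots> \<le> 2 * ?R ^ g q * \<epsilon> powr (real (g q) + (1 - 1 / real (Suc q)) - real 1)"
          using elim R by (intro mult_left_mono powr_mono') auto
        finally show ?thesis .
      qed (use R in simp)
    qed
    then show "\<exists>C>0. \<forall>\<^sub>F \<epsilon> in at_right 0. norm (u (rescale \<epsilon> \<phi>)) \<le>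
        C * \<epsilon> powr (real (g q) + (1 - 1 / real (Suc q)) - real 1)"
      using R by (intro exI[of _ "2 * ?R ^ g q"]) auto
  qed
qed

text \<open>
  The new representative differs from \<^term>\<open>v\<close> only on the set \<open>T\<close> of places where
  \<^term>\<open>v\<close> is small. Different \<open>\<sigma> p\<close> may have the same shape, so \<open>T\<close> is split shape by shape rather
  than index by index: this leaves no conflict about which values are made zero. On the rest of
  \<open>T\<close> the value must be made nonzero explicitly, as \<^term>\<open>v\<close> itself may vanish there.
\<close>

lemma nonunit_has_oscillating_representative:
  fixes x :: "((real \<Rightarrow> real) \<Rightarrow> 'a::real_normed_field) set"
  assumes x: "x \<in> carrier generalized_numbers" "x \<notin> Units generalized_numbers"
  shows "\<exists>w. representative w x \<and> zero_set w \<in> full_oscillating_sets"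
proof -
  obtain v where v: "v \<in> carrier moderate_ring" and x_eq: "x = generalized_class v"
    using x(1) by (rule generalized_numbers_cases)
  have "\<exists>\<sigma>. \<sigma> \<in> mollifiers p \<and> support_radius \<sigma> = 1 \<and>
      (\<exists>\<^sub>F t in at_right 0. norm (v (rescale t \<sigma>)) < t ^ p)" for p
    using x(2) generalized_class_in_Units[OF v, of p]
    unfolding x_eq frequently_def not_less by blast
  then obtain \<sigma> where \<sigma>: "\<And>p. \<sigma> p \<in> mollifiers p" "\<And>p. support_radius (\<sigma> p) = 1"
    "\<And>p. \<exists>\<^sub>F t in at_right 0. norm (v (rescale t (\<sigma> p))) < t ^ p"
    by metis
  define small where "small p \<psi> \<longleftrightarrow>
    shape \<psi> = \<sigma> p \<and> norm (v \<psi>) < support_radius \<psi> ^ p" for p \<psi>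
  \<comment> \<open>An index that is admissible at \<open>\<psi>\<close>: it fixes the size of the nonzero replacement value.\<close>
  define k where "k \<psi> = (LEAST p. small p \<psi>)" for \<psi>
  have k: "small (k \<psi>) \<psi>" if "small p \<psi>" for p \<psi>
    unfolding k_def using that by (rule LeastI)
  define T where "T = {\<psi> \<in> test_functions. \<exists>p. small p \<psi>}"
  have test: "\<sigma> p \<in> test_functions" for p
    using \<sigma>(1)[of p] by (simp add: mollifiers_def)
  have shape_\<sigma>: "shape (rescale t (\<sigma> p)) = \<sigma> p" "support_radius (rescale t (\<sigma> p)) = t"
    if "t > 0" for t p
    using that by (simp_all add: test shape_eq_self \<sigma>(2) support_radius_rescale)
  have "\<exists>Q. (\<exists>\<^sub>F t in at_right 0. rescale t (\<sigma> p) \<in> T \<and> Q t) \<and>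
      (\<exists>\<^sub>F t in at_right 0. rescale t (\<sigma> p) \<in> T \<and> \<not> Q t)" for p
  proof (rule frequently_split)
    show "\<exists>\<^sub>F t in at_right 0. rescale t (\<sigma> p) \<in> T"
      using frequently_eventually_conj[OF \<sigma>(3) eventually_in_unit_interval, of p]
    proof (rule frequently_elim1)
      fix t assume "(0 < t \<and> t < 1) \<and> norm (v (rescale t (\<sigma> p))) < t ^ p"
      then show "rescale t (\<sigma> p) \<in> T"
        unfolding T_def small_def
        by (auto simp: shape_\<sigma> test rescale_test_functions shape_eq_self \<sigma>(2) intro!: exI[of _ p])
    qed
  qed
  then have "\<forall>\<theta>\<in>range \<sigma>. \<exists>Q. (\<exists>\<^sub>F t in at_right 0. rescale t \<theta> \<in> T \<and> Q t) \<and>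
      (\<exists>\<^sub>F t in at_right 0. rescale t \<theta> \<in> T \<and> \<not> Q t)"
    by blast
  then obtain Q where "\<forall>\<theta>\<in>range \<sigma>. (\<exists>\<^sub>F t in at_right 0. rescale t \<theta> \<in> T \<and> Q \<theta> t) \<and>
      (\<exists>\<^sub>F t in at_right 0. rescale t \<theta> \<in> T \<and> \<not> Q \<theta> t)"
    by (rule bchoice[THEN exE])
  then have Q: "\<exists>\<^sub>F t in at_right 0. rescale t (\<sigma> p) \<in> T \<and> Q (\<sigma> p) t"
    "\<exists>\<^sub>F t in at_right 0. rescale t (\<sigma> p) \<in> T \<and> \<not> Q (\<sigma> p) t" for p
    by auto
  define w where "w = (\<lambda>\<psi>\<in>test_functions. if \<psi> \<notin> T then v \<psi>
    else if Q (shape \<psi>) (support_radius \<psi>) then 0 else of_real (support_radius \<psi> ^ k \<psi>))"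
  define u where "u = (\<lambda>\<psi>\<in>test_functions. w \<psi> - v \<psi>)"
  have "u \<in> negligible_ideal"
  proof (rule negligible_on_shapes[OF _ \<sigma>(1)])
    show "u \<in> extensional test_functions"
      by (simp add: u_def)
    fix \<psi> assume \<psi>: "\<psi> \<in> test_functions" "u \<psi> \<noteq> 0"
    then have "\<psi> \<in> T"
      by (auto simp: u_def w_def split: if_splits)
    then have "small (k \<psi>) \<psi>"
      using k by (auto simp: T_def)
    then have k_\<psi>: "shape \<psi> = \<sigma> (k \<psi>)" "norm (v \<psi>) \<le> support_radius \<psi> ^ k \<psi>"
      by (auto simp: small_def)
    have "norm (w \<psi>) \<le> support_radius \<psi> ^ k \<psi>"
      using \<psi> \<open>\<psi> \<in> T\<close> support_radius_pos[of \<psi>] by (auto simp: w_def norm_power)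
    then have "norm (u \<psi>) \<le> 2 * support_radius \<psi> ^ k \<psi>"
      using k_\<psi>(2) \<psi>(1) norm_triangle_ineq4[of "w \<psi>" "v \<psi>"] by (simp add: u_def)
    with k_\<psi>(1) show "\<exists>p. shape \<psi> = \<sigma> p \<and> norm (u \<psi>) \<le> 2 * support_radius \<psi> ^ p"
      by blast
  qed
  then have "representative w x"
    unfolding x_eq by (rule representative_perturb[OF v]) (auto simp: w_def u_def)
  moreover have "zero_set w \<in> full_oscillating_sets"
  proof -
    have "{\<epsilon> \<in> unit_interval. rescale \<epsilon> (\<sigma> p) \<in> zero_set w} \<in> oscillating_sets" for p
      unfolding oscillating_sets_iff_frequently
    proof
      show "\<exists>\<^sub>F \<epsilon> in at_right 0. rescale \<epsilon> (\<sigma> p) \<in> zero_set w"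
        using frequently_eventually_conj[OF Q(1) eventually_in_unit_interval, of p]
        by (rule frequently_elim1) (auto simp: zero_set_def w_def T_def shape_\<sigma>)
      show "\<exists>\<^sub>F \<epsilon> in at_right 0. rescale \<epsilon> (\<sigma> p) \<notin> zero_set w"
        using frequently_eventually_conj[OF Q(2) eventually_in_unit_interval, of p]
        by (rule frequently_elim1) (auto simp: zero_set_def w_def T_def shape_\<sigma>)
    qed
    then show ?thesis
      using \<sigma>(1) unfolding full_oscillating_sets_def by (auto simp: zero_set_def)
  qed
  ultimately show ?thesis
    by blast
qed

section \<open>Idempotents\<close>

lemma indicator_moderate:
  "(\<lambda>\<phi>\<in>test_functions. if \<phi> \<in> A then 1 else 0 :: 'a::real_normed_field) \<in> carrier moderate_ring"
  unfolding moderate_ring_carrier_iff moderate_iff_eventually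
proof (intro conjI exI[of _ "0::nat"] ballI exI[of _ "1::real"])
  fix \<phi> assume "\<phi> \<in> mollifiers 0"
  then have "\<phi> \<in> test_functions"
    by (simp add: mollifiers_def)
  show "\<forall>\<^sub>F \<epsilon> in at_right 0. norm ((\<lambda>\<phi>\<in>test_functions. if \<phi> \<in> A then 1 else 0 :: 'a)
      (rescale \<epsilon> \<phi>)) \<le> 1 * \<epsilon> powr (- real 0)"
    using eventually_in_unit_interval
    by eventually_elim (use \<open>\<phi> \<in> test_functions\<close> in \<open>auto simp: rescale_test_functions\<close>)
qed auto

text \<open>
  For \<^term>\<open>q\<close> so large that the exponent \<open>\<gamma> q - p\<close> is positive, the negligibility bound tends to
  zero, while the indicator is 1 at arbitrarily small dilations of some mollifier of order
  \<^term>\<open>q\<close>.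
\<close>

lemma indicator_not_negligible:
  assumes A: "A \<in> full_oscillating_sets"
  shows "(\<lambda>\<phi>\<in>test_functions. if \<phi> \<in> A then 1 else 0 :: 'a::real_normed_field) \<notin> negligible_ideal"
    (is "?e \<notin> _")
proof
  assume "?e \<in> negligible_ideal"
  then obtain p \<gamma> where \<gamma>: "\<gamma> \<in> growth_sequences"
    and bound: "\<And>q \<phi>. q \<ge> p \<Longrightarrow> \<phi> \<in> mollifiers q \<Longrightarrow>
      \<exists>C>0. \<forall>\<^sub>F \<epsilon> in at_right 0. norm (?e (rescale \<epsilon> \<phi>)) \<le> C * \<epsilon> powr (\<gamma> q - real p)"
    unfolding negligible_ideal_def eventually_at_right_zero_unit_interval by blast
  have "\<forall>\<^sub>F q in sequentially. real p < \<gamma> q"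
    using \<gamma> by (auto simp: growth_sequences_def filterlim_at_top_dense)
  then obtain q where q: "q \<ge> p" "real p < \<gamma> q"
    unfolding eventually_sequentially by (meson le_cases order_refl)
  obtain \<phi> where \<phi>: "\<phi> \<in> mollifiers q"
    and "{\<epsilon> \<in> unit_interval. rescale \<epsilon> \<phi> \<in> A} \<in> oscillating_sets"
    using A unfolding full_oscillating_sets_def by blast
  then have freq: "\<exists>\<^sub>F \<epsilon> in at_right 0. rescale \<epsilon> \<phi> \<in> A"
    by (simp add: oscillating_sets_iff_frequently)
  obtain C where C: "\<forall>\<^sub>F \<epsilon> in at_right 0. norm (?e (rescale \<epsilon> \<phi>)) \<le> C * \<epsilon> powr (\<gamma> q - real p)"
    using bound[OF q(1) \<phi>] by blast
  have "((\<lambda>\<epsilon>. C * \<epsilon> powr (\<gamma> q - real p)) \<longlongrightarrow> C * 0 powr (\<gamma> q - real p)) (at_right 0)"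
    using q(2) eventually_in_unit_interval
    by (intro tendsto_intros tendsto_powr2) (auto elim: eventually_mono)
  then have "\<forall>\<^sub>F \<epsilon> in at_right 0. C * \<epsilon> powr (\<gamma> q - real p) < 1"
    using q(2) by (intro order_tendstoD(2)) auto
  with C have "\<forall>\<^sub>F \<epsilon> in at_right 0. rescale \<epsilon> \<phi> \<notin> A"
  proof eventually_elim
    case (elim \<epsilon>)
    then have "norm (?e (rescale \<epsilon> \<phi>)) < 1"
      by linarith
    moreover have "A \<subseteq> test_functions"
      using A by (simp add: full_oscillating_sets_def)
    ultimately show ?case
      by auto
  qed
  with freq show False
    by (simp add: frequently_def)
qed

lemma oscillating_representative_gives_idempotent:
  fixes x :: "((real \<Rightarrow> real) \<Rightarrow> 'a::real_normed_field) set"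
  assumes x: "x \<in> carrier generalized_numbers"
    and w: "representative w x" "zero_set w \<in> full_oscillating_sets"
  shows "\<exists>e\<in>carrier generalized_numbers. e \<noteq> \<zero>\<^bsub>generalized_numbers\<^esub> \<and>
    e \<otimes>\<^bsub>generalized_numbers\<^esub> e = e \<and> x \<otimes>\<^bsub>generalized_numbers\<^esub> e = \<zero>\<^bsub>generalized_numbers\<^esub>"
proof -
  define i :: "(real \<Rightarrow> real) \<Rightarrow> 'a" where
    "i = (\<lambda>\<phi>\<in>test_functions. if \<phi> \<in> zero_set w then 1 else 0)"
  have i: "i \<in> carrier moderate_ring" "i \<notin> negligible_ideal"
    unfolding i_def using indicator_moderate indicator_not_negligible[OF w(2)] by blast+
  obtain v where v: "v \<in> carrier moderate_ring" "x = generalized_class v"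
    using x by (rule generalized_numbers_cases)
  with w(1) have w': "w \<in> carrier moderate_ring" "x = generalized_class w"
    by (simp_all add: representative_iff)
  have "(\<lambda>\<phi>\<in>test_functions. i \<phi> * i \<phi>) = i"
    "(\<lambda>\<phi>\<in>test_functions. w \<phi> * i \<phi>) = \<zero>\<^bsub>moderate_ring\<^esub>"
    by (auto simp: i_def fun_eq_iff zero_set_def moderate_ring_def)
  moreover have "generalized_class \<zero>\<^bsub>moderate_ring\<^esub> = \<zero>\<^bsub>generalized_numbers :: ((real \<Rightarrow> real) \<Rightarrow> 'a) set ring\<^esub>"
  proof -
    interpret M: cring "moderate_ring :: ((real \<Rightarrow> real) \<Rightarrow> 'a) ring"
      by (rule cring_moderate_ring)
    show ?thesis
      by (simp add: generalized_class_eq_zero_iff negligible_zero)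
  qed
  ultimately show ?thesis
    using i w' generalized_class_carrier[OF i(1)]
    by (intro bexI[of _ "generalized_class i"])
      (simp_all add: generalized_class_mult generalized_class_eq_zero_iff)
qed

lemma (in cring) annihilates_nonzero_not_Unit:
  assumes "x \<in> carrier R" "e \<in> carrier R" "e \<noteq> \<zero>" "x \<otimes> e = \<zero>"
  shows "x \<notin> Units R"
proof
  assume "x \<in> Units R"
  then have "e = inv x \<otimes> x \<otimes> e"
    using assms(2) by simp
  also have "\<dots> = inv x \<otimes> (x \<otimes> e)"
    using assms(1,2) \<open>x \<in> Units R\<close> by (intro m_assoc) auto
  also have "\<dots> = \<zero>"
    using assms(4) \<open>x \<in> Units R\<close> by simp
  finally show False
    using assms(3) by simp
qed

theorem theorem3p13:
  fixes x :: "((real \<Rightarrow> real) \<Rightarrow> 'a::real_normed_field) set"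
  assumes "x \<in> carrier generalized_numbers"
  shows "(x \<in> Units generalized_numbers \<longleftrightarrow>
            (\<forall>v. representative v x \<longrightarrow> zero_set v \<notin> full_oscillating_sets)) \<and>
         (x \<notin> Units generalized_numbers \<longleftrightarrow>
            (\<exists>e\<in>carrier generalized_numbers.
               e \<noteq> \<zero>\<^bsub>generalized_numbers\<^esub> \<and>
               e [^]\<^bsub>generalized_numbers\<^esub> (2::nat) = e \<and>
               x \<otimes>\<^bsub>generalized_numbers\<^esub> e = \<zero>\<^bsub>generalized_numbers\<^esub>)) \<and>
         (x \<noteq> \<zero>\<^bsub>generalized_numbers\<^esub> \<and> x \<notin> Units generalized_numbers \<longrightarrow>
            zero_divisor generalized_numbers x)"
proof -
  interpret G: cring "generalized_numbers :: ((real \<Rightarrow> real) \<Rightarrow> 'a) set ring"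
    by (rule cring_generalized_numbers)
  have square: "e [^]\<^bsub>generalized_numbers\<^esub> (2::nat) = e \<otimes>\<^bsub>generalized_numbers\<^esub> e"
    if "e \<in> carrier generalized_numbers" for e :: "((real \<Rightarrow> real) \<Rightarrow> 'a) set"
    using that by (simp add: numeral_2_eq_2)
  let ?osc = "\<exists>w. representative w x \<and> zero_set w \<in> full_oscillating_sets"
  let ?idem = "\<exists>e\<in>carrier generalized_numbers. e \<noteq> \<zero>\<^bsub>generalized_numbers\<^esub> \<and>
      e [^]\<^bsub>generalized_numbers\<^esub> (2::nat) = e \<and> x \<otimes>\<^bsub>generalized_numbers\<^esub> e = \<zero>\<^bsub>generalized_numbers\<^esub>"
  have "x \<notin> Units generalized_numbers \<Longrightarrow> ?osc"
    using nonunit_has_oscillating_representative[OF assms] .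
  moreover have "?osc \<Longrightarrow> ?idem"
    using oscillating_representative_gives_idempotent[OF assms] square by metis
  moreover have "?idem \<Longrightarrow> x \<notin> Units generalized_numbers"
    using G.annihilates_nonzero_not_Unit[OF assms] by blast
  ultimately have osc: "x \<notin> Units generalized_numbers \<longleftrightarrow> ?osc"
    and idem: "x \<notin> Units generalized_numbers \<longleftrightarrow> ?idem"
    by blast+
  have "zero_divisor generalized_numbers x"
    if "x \<noteq> \<zero>\<^bsub>generalized_numbers\<^esub>" "x \<notin> Units generalized_numbers"
    using that assms idem unfolding zero_divisor_def by blast
  with osc idem show ?thesis
    by blast
qed

end
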